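(* Let $k>1$ be an odd integer. For an integer $q>2$, let $S_k(q)$ be the $\mathbb{Q}$-linear span of the numbers $\zeta(k,a/q)/\pi^k$ for $1\le a<q$, $\gcd(a,q)=1$. Then there exists an integer $q_0>2$ such that $$\dim_{\mathbb{Q}}S_k(q)\ge\frac{\varphi(q)}{2}+1$$ for every integer $q>2$ coprime to $q_0$.
   Context: For $0<x\le1$ and $\Re(s)>1$, the Hurwitz zeta function is $\zeta(s,x)=\sum_{n\ge0}(n+x)^{-s}$. $\varphi$ is Euler's totient function. *)

theory Defs
  imports "HOL-Analysis.Analysis" "HOL-Number_Theory.Totient"
begin

text \<open>Meaningful for \<open>Re s > 1\<close> and \<open>0 < x \<le> 1\<close>, where the series converges absolutely. On positive
  reals \<open>powr\<close> uses the real logarithm. The value lives in the complex numbers even when \<open>s\<close>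
  is real.\<close>

definition hurwitz_zeta :: "complex \<Rightarrow> real \<Rightarrow> complex" where
  "hurwitz_zeta s x = (\<Sum>n. complex_of_real (real n + x) powr (- s))"

definition rat_scale :: "rat \<Rightarrow> complex \<Rightarrow> complex" where
  "rat_scale r z = of_rat r * z"

global_interpretation rat_vs: vector_space rat_scale
  defines rat_span = rat_vs.span
      and rat_dim = rat_vs.dim
  by unfold_locales (simp_all add: rat_scale_def of_rat_add of_rat_mult algebra_simps)

definition hurwitz_space :: "nat \<Rightarrow> nat \<Rightarrow> complex set" where
  "hurwitz_space k q =
     rat_span {hurwitz_zeta (of_nat k) (real a / real q) / of_real pi ^ k | a :: nat.
       1 \<le> a \<and> a < q \<and> coprime a q}"

end

theory Submission
  imports Defs "HOL-Computational_Algebra.Polynomial"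
begin

text \<open>Let \<open>f\<^sub>q(a) = (\<zeta>(k, a/q) - \<zeta>(k, 1 - a/q)) / \<pi>^k\<close>. Differentiating the reflection formula of the
  digamma function shows that \<open>f\<^sub>q(a)\<close> is \<open>\<i>\<close> times an element of the \<open>q\<close>-th cyclotomic field, with
  conjugates \<open>f\<^sub>q(a t)\<close>. The \<open>\<phi>(q)/2\<close> numbers \<open>f\<^sub>q(a)\<close> with \<open>a < q/2\<close> are linearly independent (Okada),
  and \<open>\<zeta>(k)/\<pi>^k\<close> also belongs to \<open>S\<^sub>k(q)\<close>, so the bound can fail only if \<open>\<zeta>(k)/\<pi>^k\<close> lies in the span of
  the \<open>f\<^sub>q(a)\<close>. This cannot happen for two coprime moduli \<open>q\<close>, \<open>r\<close>: the automorphism of the \<open>q r\<close>-th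
  cyclotomic field that is complex conjugation on the \<open>q\<close>-th and the identity on the \<open>r\<close>-th roots of
  unity would map \<open>\<zeta>(k)/\<pi>^k\<close> to its negative and to itself. Hence any \<open>q\<close> for which the bound fails
  serves as \<open>q\<^sub>0\<close>.\<close>

section \<open>Conjugation of relations between roots of unity\<close>

text \<open>A single theory of evaluation serves integer coefficients, where divisibility by a prime
  makes sense, and rational coefficients, which occur in the linear relations.\<close>

locale complex_ring_hom =
  fixes h :: "'a::comm_ring_1 \<Rightarrow> complex"
  assumes hom_0: "h 0 = 0" and hom_1: "h 1 = 1"
    and hom_add: "h (a + b) = h a + h b" and hom_mult: "h (a * b) = h a * h b"
begin

definition ev :: "'a poly \<Rightarrow> complex \<Rightarrow> complex" where
  "ev P x = poly (map_poly h P) x"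

lemma ev_0 [simp]: "ev 0 x = 0"
  by (simp add: ev_def)

lemma ev_pCons: "ev (pCons a P) x = h a + x * ev P x"
  by (simp add: ev_def map_poly_pCons hom_0)

lemma ev_monom: "ev (monom a n) x = h a * x ^ n"
  by (simp add: ev_def map_poly_monom hom_0 poly_monom)

lemma ev_add: "ev (P + Q) x = ev P x + ev Q x"
  by (induction P Q rule: poly_induct2) (simp_all add: ev_pCons hom_add hom_0 algebra_simps)

lemma ev_smult: "ev (smult c P) x = h c * ev P x"
  by (induction P) (simp_all add: ev_pCons hom_mult algebra_simps)

lemma ev_mult: "ev (P * Q) x = ev P x * ev Q x"
  by (induction P) (simp_all add: ev_pCons ev_add ev_smult hom_0 algebra_simps)

lemma ev_pcompose: "ev (pcompose P Q) x = ev P (ev Q x)"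
  by (induction P) (simp_all add: pcompose_pCons ev_pCons ev_add ev_mult hom_0)

lemma ev_power: "ev (P ^ n) x = ev P x ^ n"
  by (induction n) (simp_all add: ev_mult, simp add: ev_def hom_1)

lemma ev_sum: "ev (\<Sum>i\<in>A. P i) x = (\<Sum>i\<in>A. ev (P i) x)"
  by (induction A rule: infinite_finite_induct) (simp_all add: ev_add)

lemma ev_minus: "ev (- P) x = - ev P x"
  using ev_add[of P "- P" x] by (simp add: add_eq_0_iff)

lemma ev_diff: "ev (P - Q) x = ev P x - ev Q x"
  using ev_add[of P "- Q" x] by (simp add: ev_minus)

end

global_interpretation int_ev: complex_ring_hom "of_int :: int \<Rightarrow> complex"
  defines ipoly = int_ev.ev
  by unfold_locales auto

global_interpretation rat_ev: complex_ring_hom "of_rat :: rat \<Rightarrow> complex"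
  defines rpoly = rat_ev.ev
  by unfold_locales (auto simp: of_rat_add of_rat_mult)

lemma ipoly_eq_sum: "ipoly P x = (\<Sum>i\<le>degree P. of_int (coeff P i) * x ^ i)"
proof -
  have "ipoly P x = ipoly (\<Sum>i\<le>degree P. monom (coeff P i) i) x"
    by (simp add: poly_as_sum_of_monoms)
  then show ?thesis
    by (simp add: int_ev.ev_sum int_ev.ev_monom)
qed

lemma ipoly_of_nat_mult: "ipoly (of_nat p * P) x = of_nat p * ipoly P x"
  by (simp add: int_ev.ev_smult of_nat_poly)

text \<open>Conjugation is proved for integer coefficients; this carries it over to rational ones.
  One pair of d and Q works for all x, so the factor d can be cancelled at both conjugate
  points.\<close>

lemma rat_poly_clear_denominators:
  fixes P :: "rat poly"
  shows "\<exists>d Q. d > 0 \<and> (\<forall>x. ipoly Q x = of_int d * rpoly P x)"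
proof (induction P)
  case 0
  have "ipoly 0 x = of_int 1 * rpoly 0 x" for x by simp
  then show ?case by (metis zero_less_one)
next
  case (pCons a P)
  then obtain d Q where d: "d > 0" and Q: "\<And>x. ipoly Q x = of_int d * rpoly P x" by auto
  obtain m n where a: "quotient_of a = (m, n)" by force
  then have n: "n > 0" and amn: "a = of_int m / of_int n"
    by (auto simp: quotient_of_denom_pos quotient_of_div)
  have na: "of_int n * of_rat a = (of_int m :: complex)"
    using n by (simp add: amn of_rat_divide)
  have "ipoly (pCons (d * m) (smult n Q)) x = of_int (n * d) * rpoly (pCons a P) x" for x
    by (simp add: int_ev.ev_pCons rat_ev.ev_pCons int_ev.ev_smult Q ring_distribs flip: na)
  moreover have "n * d > 0" using n d by simp
  ultimately show ?case by blast
qed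

section \<open>Frobenius congruences modulo a prime\<close>

lemma prime_dvd_add_power_diff:
  fixes x y :: "'a::comm_ring_1"
  assumes "prime p"
  shows "of_nat p dvd (x + y) ^ p - (x ^ p + y ^ p)"
proof -
  have p: "p > 0" using assms by (simp add: prime_gt_0_nat)
  have "(x + y) ^ p = (\<Sum>k\<le>p. of_nat (p choose k) * x ^ k * y ^ (p - k))"
    by (rule binomial_ring)
  \<comment> \<open>Only the outer terms k = 0 and k = p have binomial coefficients prime to
    p.\<close>
  also have "{..p} = insert 0 (insert p {0<..<p})"
    by auto
  finally have eq: "(x + y) ^ p - (x ^ p + y ^ p)
      = (\<Sum>k\<in>{0<..<p}. of_nat (p choose k) * x ^ k * y ^ (p - k))"
    using p by simp
  show ?thesis
    unfolding eq
  proof (intro dvd_sum)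
    fix k assume "k \<in> {0<..<p}"
    then have "p dvd p choose k"
      using assms by (intro dvd_choose_prime) auto
    then have "(of_nat p :: 'a) dvd of_nat (p choose k)" 
      by (auto elim!: dvdE)
    then show "of_nat p dvd of_nat (p choose k) * x ^ k * y ^ (p - k)"
      by simp
  qed
qed

text \<open>Fermat's little theorem, by induction from 0 in both directions with y = 1 in the
  binomial congruence.\<close>

lemma prime_dvd_int_minus_power:
  fixes a :: int
  assumes "prime p"
  shows "int p dvd a - a ^ p"
proof (induction a rule: int_induct[of _ 0])
  case base
  then show ?case using prime_gt_0_nat[OF assms] by (simp add: zero_power)
next
  case (step1 a)
  have "int p dvd (a - a ^ p) - ((a + 1) ^ p - (a ^ p + 1 ^ p))"
    using dvd_diff[OF step1(2) prime_dvd_add_power_diff[OF assms, of a 1]] by simp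
  then show ?case by (simp add: algebra_simps)
next
  case (step2 a)
  have "int p dvd (a - a ^ p) + ((a - 1 + 1) ^ p - ((a - 1) ^ p + 1 ^ p))"
    using dvd_add[OF step2(2) prime_dvd_add_power_diff[OF assms, of "a - 1" 1]] by simp
  then show ?case by (simp add: algebra_simps)
qed

text \<open>Horner induction: the p-th power is additive modulo p, it is compatible with
  multiplication by X, and the constants are fixed by Fermat's little theorem.\<close>

lemma prime_dvd_pcompose_monom_diff_power:
  fixes P :: "int poly"
  assumes p: "prime p"
  shows "of_nat p dvd pcompose P (monom 1 p) - P ^ p"
proof (induction P)
  case 0
  then show ?case using prime_gt_0_nat[OF p] by (simp add: zero_power)
next
  case (pCons a P)
  have "int p dvd a - a ^ p" by (rule prime_dvd_int_minus_power[OF p])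
  then have 1: "of_nat p dvd [:a:] - [:a:] ^ p"
    by (simp add: of_nat_poly poly_const_pow const_poly_dvd_const_poly_iff)
  have X: "monom 1 p = (monom 1 1 :: int poly) ^ p"
    by (simp add: monom_power)
  define Y where "Y = (monom 1 1 :: int poly) * P"
  have 2: "of_nat p dvd (monom 1 1 :: int poly) ^ p * (pcompose P (monom 1 p) - P ^ p)"
    using pCons.IH by simp
  have 3: "of_nat p dvd ([:a:] + Y) ^ p - ([:a:] ^ p + Y ^ p)"
    by (rule prime_dvd_add_power_diff[OF p])
  have eq: "pCons a P = [:a:] + Y"
    by (simp add: Y_def monom_altdef)
  have "pcompose (pCons a P) (monom 1 p) - pCons a P ^ p =
      ([:a:] - [:a:] ^ p) + (monom 1 1 :: int poly) ^ p * (pcompose P (monom 1 p) - P ^ p)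
      - (([:a:] + Y) ^ p - ([:a:] ^ p + Y ^ p))"
    unfolding eq[symmetric] by (simp add: pcompose_pCons X Y_def power_mult_distrib algebra_simps)
  then show ?case
    using dvd_diff[OF dvd_add[OF 1 2] 3] by simp
qed

lemma ipoly_power_prime_eq:
  assumes "prime p"
  shows "\<exists>Q. \<forall>x. ipoly P (x ^ p) = ipoly P x ^ p + of_nat p * ipoly Q x"
proof -
  obtain Q where Q: "pcompose P (monom 1 p) - P ^ p = of_nat p * Q"
    using prime_dvd_pcompose_monom_diff_power[OF assms] by (auto elim: dvdE)
  have "ipoly P (x ^ p) = ipoly P x ^ p + of_nat p * ipoly Q x" for x
  proof -
    have "ipoly P (x ^ p) - ipoly P x ^ p = ipoly (pcompose P (monom 1 p) - P ^ p) x"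
      by (simp add: int_ev.ev_diff int_ev.ev_pcompose int_ev.ev_monom int_ev.ev_power)
    then show ?thesis unfolding Q ipoly_of_nat_mult by (simp add: algebra_simps)
  qed
  then show ?thesis by blast
qed

section \<open>Divisibility by primes in the ring generated by a root of unity\<close>

lemma exists_rational_functional:
  assumes "\<alpha> \<noteq> 0"
  obtains \<phi> :: "complex \<Rightarrow> rat" where "\<phi> \<alpha> = 1"
    and "\<And>x y. \<phi> (x + y) = \<phi> x + \<phi> y" and "\<And>r x. \<phi> (of_rat r * x) = r * \<phi> x"
proof -
  have ind: "rat_vs.independent {\<alpha>}" using assms by simp
  \<comment> \<open>Extending \<alpha> to a basis of the complex numbers over the rationals makes
    its coordinate a functional with value 1 there.\<close>
  define B where "B = rat_vs.extend_basis {\<alpha>}"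
  have B: "rat_vs.independent B" "rat_vs.span B = UNIV" "\<alpha> \<in> B"
    using rat_vs.extend_basis_superset[OF ind] rat_vs.independent_extend_basis[OF ind]
      rat_vs.span_extend_basis[OF ind] by (auto simp: B_def)
  let ?\<phi> = "\<lambda>x. rat_vs.representation B x \<alpha>"
  show ?thesis
  proof (rule that[of ?\<phi>])
    show "?\<phi> \<alpha> = 1" using B by (simp add: rat_vs.representation_basis)
    show "?\<phi> (x + y) = ?\<phi> x + ?\<phi> y" for x y
      using B by (subst rat_vs.representation_add) auto
    show "?\<phi> (of_rat r * x) = r * ?\<phi> x" for r x
      using B rat_vs.representation_scale[of B x r] by (simp add: rat_scale_def)
  qed
qed

text \<open>A rational functional normalised at \<open>\<alpha>\<close> takes values with bounded denominators on
  \<open>\<int>[\<zeta>]\<close>, so \<open>\<alpha>\<close> is divisible there by small primes only.\<close>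

lemma root_of_unity_ring_bounded_divisors:
  fixes \<zeta> \<alpha> :: complex
  assumes N: "N > 0" "\<zeta> ^ N = 1" and \<alpha>: "\<alpha> \<noteq> 0"
  shows "\<exists>A. \<forall>p>A. \<forall>Q. \<alpha> \<noteq> of_nat p * ipoly Q \<zeta>"
proof -
  obtain \<phi> where \<phi>: "\<phi> \<alpha> = (1 :: rat)" "\<And>x y. \<phi> (x + y) = \<phi> x + \<phi> y"
    and \<phi>r: "\<And>r x. \<phi> (of_rat r * x) = r * \<phi> x"
    using exists_rational_functional[OF \<alpha>] by blast
  have \<phi>0: "\<phi> 0 = 0" using \<phi>(2)[of 0 0] by simp
  have \<phi>i: "\<phi> (of_int m * x) = of_int m * \<phi> x" for m x
    using \<phi>r[of "of_int m" x] by simp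
  have \<phi>s: "\<phi> (\<Sum>i\<in>I. f i) = (\<Sum>i\<in>I. \<phi> (f i))" for I :: "nat set" and f
    by (induction I rule: infinite_finite_induct) (simp_all add: \<phi>0 \<phi>(2))
  \<comment> \<open>A common denominator of the functional on the powers of \<zeta>; by periodicity
    the first N powers suffice.\<close>
  define D where "D = (\<Prod>j<N. snd (quotient_of (\<phi> (\<zeta> ^ j))))"
  have D0: "D > 0" unfolding D_def by (intro prod_pos) (simp add: quotient_of_denom_pos')
  have Dj: "of_int D * \<phi> (\<zeta> ^ j) \<in> \<int>" if "j < N" for j
  proof -
    obtain m n where mn: "quotient_of (\<phi> (\<zeta> ^ j)) = (m, n)" by force
    then have "n dvd D"
      using that unfolding D_def by (metis dvd_prodI finite_lessThan lessThan_iff snd_conv)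
    then obtain e where e: "D = n * e" by (auto elim: dvdE)
    have "n > 0" "\<phi> (\<zeta> ^ j) = of_int m / of_int n"
      using mn by (auto simp: quotient_of_denom_pos quotient_of_div)
    then have "of_int D * \<phi> (\<zeta> ^ j) = of_int (e * m)" by (simp add: e)
    then show ?thesis by (metis Ints_of_int)
  qed
  have Di: "of_int D * \<phi> (\<zeta> ^ i) \<in> \<int>" for i
  proof -
    have "\<zeta> ^ i = \<zeta> ^ (N * (i div N) + i mod N)" by simp
    also have "\<dots> = \<zeta> ^ (i mod N)" by (simp only: power_add power_mult N(2)) simp
    finally show ?thesis using Dj[of "i mod N"] N(1) by simp
  qed
  have DQ: "of_int D * \<phi> (ipoly Q \<zeta>) \<in> \<int>" for Q
  proof -
    have "of_int D * \<phi> (ipoly Q \<zeta>) = (\<Sum>i\<le>degree Q. of_int (coeff Q i) * (of_int D * \<phi> (\<zeta> ^ i)))"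
      by (simp add: ipoly_eq_sum \<phi>s \<phi>i sum_distrib_left mult.left_commute)
    also have "\<dots> \<in> \<int>" by (intro Ints_sum Ints_mult Di) auto
    finally show ?thesis .
  qed
  \<comment> \<open>If \<alpha> were p times a ring element, applying D times the functional would
    exhibit D as an integer multiple of p, which forces p \<le> D.\<close>
  have "\<alpha> \<noteq> of_nat p * ipoly Q \<zeta>" if p: "p > nat D" for p Q
  proof
    assume "\<alpha> = of_nat p * ipoly Q \<zeta>"
    then have "\<phi> \<alpha> = of_nat p * \<phi> (ipoly Q \<zeta>)"
      using \<phi>i[of "int p" "ipoly Q \<zeta>"] by simp
    then have "of_int D = of_nat p * (of_int D * \<phi> (ipoly Q \<zeta>))"
      by (simp add: \<phi>(1))
    moreover obtain c where "of_int D * \<phi> (ipoly Q \<zeta>) = of_int c"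
      using DQ by (auto elim: Ints_cases)
    ultimately have "(of_int D :: rat) = of_int (int p * c)" by simp
    then have "int p dvd D" by (metis dvd_triv_left of_int_eq_iff)
    then show False using D0 p zdvd_imp_le by fastforce
  qed
  then show ?thesis by blast
qed

text \<open>If P vanishes at \<zeta>^j, the Frobenius congruence makes its value at \<zeta>^(j p)
  divisible by p, and a nonzero value is divisible by small primes only. The powers of \<zeta> take
  at most N values, so one threshold serves all j.\<close>

lemma ipoly_root_power_large_prime:
  fixes \<zeta> :: complex
  assumes N: "N > 0" "\<zeta> ^ N = 1"
  shows "\<exists>A. \<forall>p>A. prime p \<longrightarrow> (\<forall>j. ipoly P (\<zeta> ^ j) = 0 \<longrightarrow> ipoly P (\<zeta> ^ (j * p)) = 0)"
proof -
  have "\<exists>A. \<forall>p>A. \<forall>Q. ipoly P (\<zeta> ^ i) \<noteq> 0 \<longrightarrow> ipoly P (\<zeta> ^ i) \<noteq> of_nat p * ipoly Q \<zeta>" for i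
    using root_of_unity_ring_bounded_divisors[OF N] by blast
  then obtain A where A: "\<And>i p Q. p > A i \<Longrightarrow> ipoly P (\<zeta> ^ i) \<noteq> 0 \<Longrightarrow>
      ipoly P (\<zeta> ^ i) \<noteq> of_nat p * ipoly Q \<zeta>"
    by metis
  have "ipoly P (\<zeta> ^ (j * p)) = 0"
    \<comment> \<open>The sum bounds every \<open>A i\<close> with i < N, and exponents matter only
      modulo N.\<close>
    if p: "p > (\<Sum>i<N. A i)" "prime p" and 0: "ipoly P (\<zeta> ^ j) = 0" for p j
  proof (rule ccontr)
    assume *: "ipoly P (\<zeta> ^ (j * p)) \<noteq> 0"
    define i where "i = (j * p) mod N"
    have "\<zeta> ^ (j * p) = \<zeta> ^ (N * (j * p div N) + i)" by (simp add: i_def)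
    also have "\<dots> = \<zeta> ^ i" by (simp only: power_add power_mult N(2)) simp
    finally have i: "\<zeta> ^ (j * p) = \<zeta> ^ i" .
    have "i < N" using N by (simp add: i_def)
    then have "A i \<le> (\<Sum>i<N. A i)" by (intro member_le_sum) auto
    then have pA: "p > A i" using p by simp
    obtain Q where Q: "\<And>x. ipoly P (x ^ p) = ipoly P x ^ p + of_nat p * ipoly Q x"
      using ipoly_power_prime_eq[OF p(2)] by blast
    have "ipoly P (\<zeta> ^ i) = of_nat p * ipoly (pcompose Q (monom 1 j)) \<zeta>"
      using Q[of "\<zeta> ^ j"] 0 p(2) prime_gt_0_nat[of p]
      by (simp add: i[symmetric] power_mult int_ev.ev_pcompose int_ev.ev_monom)
    then show False using A[OF pA] * i by metis
  qed
  then show ?thesis by blast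
qed

text \<open>Landau's argument: every exponent coprime to \<open>N\<close> is congruent modulo \<open>N\<close> to a number
  all of whose prime factors are large.\<close>

theorem ipoly_root_of_unity_conjugate:
  fixes \<zeta> :: complex
  assumes N: "N > 0" "\<zeta> ^ N = 1" and t: "coprime t N" and 0: "ipoly P \<zeta> = 0"
  shows "ipoly P (\<zeta> ^ t) = 0"
proof -
  obtain A where A: "\<And>p j. p > A \<Longrightarrow> prime p \<Longrightarrow> ipoly P (\<zeta> ^ j) = 0 \<Longrightarrow> ipoly P (\<zeta> ^ (j * p)) = 0"
    using ipoly_root_power_large_prime[OF N] by blast
  \<comment> \<open>The prime factors of m are adjoined one at a time; j is arbitrary because the
    exponent grows along the way.\<close>
  have large: "ipoly P (\<zeta> ^ (j * m)) = 0"
    if "m > 0" "\<And>p. prime p \<Longrightarrow> p dvd m \<Longrightarrow> p > A" "ipoly P (\<zeta> ^ j) = 0" for m j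
    using that
  proof (induction m arbitrary: j rule: less_induct)
    case (less m)
    show ?case
    proof (cases "m = 1")
      case False
      then obtain p where p: "prime p" "p dvd m" using prime_factor_nat by blast
      then obtain m' where m': "m = p * m'" by (auto elim: dvdE)
      have "m' < m" "m' > 0" using m' less.prems(1) prime_gt_1_nat[OF p(1)] by auto
      moreover have "ipoly P (\<zeta> ^ (j * p)) = 0"
        using A less.prems p by blast
      ultimately have "ipoly P (\<zeta> ^ (j * p * m')) = 0"
        using less.IH less.prems(2) m' by (meson dvd_mult)
      then show ?thesis by (simp add: m' mult.assoc)
    qed (use less.prems in simp)
  qed
  \<comment> \<open>A small prime dividing t divides neither N nor the product over
    \<open>S\<close>, while any other small prime divides that product but not t. So no prime up to
    A divides \<open>m\<close>, which is congruent to t modulo N.\<close>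
  define S where "S = {p. prime p \<and> p \<le> A \<and> \<not> p dvd t}"
  have fin: "finite S" by (rule finite_subset[of _ "{..A}"]) (auto simp: S_def)
  define m where "m = t + N * \<Prod>S"
  have "m > 0"
    using N fin by (auto simp: m_def S_def prod_pos prime_gt_0_nat)
  moreover have "p > A" if p: "prime p" "p dvd m" for p
  proof (rule ccontr)
    assume pA: "\<not> p > A"
    show False
    proof (cases "p dvd t")
      case True
      then have "p dvd N * \<Prod>S" using p(2) by (simp add: m_def dvd_add_right_iff)
      moreover have "\<not> p dvd N"
        using True t p(1) by (meson coprime_common_divisor not_prime_unit)
      moreover have "\<not> p dvd \<Prod>S"
        using True p(1) fin unfolding S_def
        by (subst prime_dvd_prod_iff) (auto dest: primes_dvd_imp_eq)
      ultimately show False using p(1) by (simp add: prime_dvd_mult_iff)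
    next
      case False
      then have "p dvd \<Prod>S"
        using p pA fin by (intro dvd_prodI[of S p "\<lambda>x. x"]) (auto simp: S_def)
      then show False using False p(2) by (simp add: m_def dvd_add_left_iff)
    qed
  qed
  ultimately have "ipoly P (\<zeta> ^ (1 * m)) = 0" using 0 by (intro large) auto
  moreover have "\<zeta> ^ m = \<zeta> ^ t" by (simp add: m_def power_add power_mult N(2))
  ultimately show ?thesis by simp
qed

corollary rpoly_root_of_unity_conjugate:
  fixes \<zeta> :: complex
  assumes "N > 0" "\<zeta> ^ N = 1" "coprime t N" "rpoly P \<zeta> = 0"
  shows "rpoly P (\<zeta> ^ t) = 0"
proof -
  obtain d Q where d: "d > 0" and Q: "\<And>x. ipoly Q x = of_int d * rpoly P x"
    using rat_poly_clear_denominators by blast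
  have "ipoly Q (\<zeta> ^ t) = 0"
    using assms by (intro ipoly_root_of_unity_conjugate[of N]) (auto simp: Q)
  then show ?thesis using d by (simp add: Q)
qed

section \<open>The reflection formula\<close>

text \<open>The function \<open>u = - \<i> cot (\<pi> z)\<close> satisfies \<open>u' = \<i> \<pi> (1 - u\<^sup>2)\<close>, and \<open>cot_poly n\<close> expresses its
  \<open>n\<close>-th derivative, divided by \<open>(\<i> \<pi>) ^ n\<close>, in terms of \<open>u\<close>.\<close>

fun cot_poly :: "nat \<Rightarrow> rat poly" where
  "cot_poly 0 = monom 1 1"
| "cot_poly (Suc n) = (1 - monom 1 2) * pderiv (cot_poly n)"

lemma rpoly_has_field_derivative:
  "(rpoly P has_field_derivative rpoly (pderiv P) z) (at z within A)"
proof (induction P)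
  case (pCons a P)
  have "((\<lambda>z. of_rat a + z * rpoly P z) has_field_derivative
      rpoly P z + z * rpoly (pderiv P) z) (at z within A)"
    by (auto intro!: derivative_eq_intros pCons.IH)
  then show ?case
    by (simp add: rat_ev.ev_pCons[abs_def] pderiv_pCons rat_ev.ev_add rat_ev.ev_pCons)
qed (simp add: rat_ev.ev_def[abs_def])

lemma has_field_derivative_i_cot:
  fixes z :: complex
  assumes "z \<notin> \<int>"
  shows "((\<lambda>z. - \<i> * cot (of_real pi * z)) has_field_derivative
           \<i> * of_real pi * (1 - (- \<i> * cot (of_real pi * z))\<^sup>2)) (at z)"
proof -
  have s: "sin (of_real pi * z) \<noteq> 0" using assms by (subst sin_eq_0) auto
  then have "1 + (cot (of_real pi * z))\<^sup>2 = inverse ((sin (of_real pi * z))\<^sup>2)"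
    using sin_cos_squared_add[of "of_real pi * z"]
    by (simp add: cot_def power_divide add_divide_distrib[symmetric] divide_simps)
  then have "\<i> * of_real pi * (1 - (- \<i> * cot (of_real pi * z))\<^sup>2)
      = - \<i> * (- inverse ((sin (of_real pi * z))\<^sup>2) * of_real pi)"
    by (simp add: power_mult_distrib)
  then show ?thesis
    by (auto intro!: derivative_eq_intros DERIV_chain2[OF DERIV_cot] s)
qed

lemma open_Compl_Ints: "open (- \<int> :: complex set)"
  by (simp add: open_Compl)

text \<open>The logarithmic derivative of Euler's reflection formula for the Gamma function.\<close>

lemma Digamma_reflection:
  fixes z :: complex
  assumes z: "z \<notin> \<int>"
  shows "Digamma (1 - z) - Digamma z = of_real pi * cot (of_real pi * z)"
proof -
  have z': "1 - z \<notin> \<int>" using z Ints_diff[of 1 "1 - z"] by auto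
  have np: "z \<notin> \<int>\<^sub>\<le>\<^sub>0" "1 - z \<notin> \<int>\<^sub>\<le>\<^sub>0" using z z' nonpos_Ints_subset_Ints by blast+
  have s: "sin (of_real pi * z) \<noteq> 0" using z by (subst sin_eq_0) auto
  have "((\<lambda>z. Gamma z * Gamma (1 - z)) has_field_derivative
      Gamma z * Gamma (1 - z) * (Digamma z - Digamma (1 - z))) (at z)"
    using np by (auto intro!: derivative_eq_intros simp: algebra_simps)
  moreover have "((\<lambda>z. of_real pi / sin (of_real pi * z)) has_field_derivative
      - (of_real pi / sin (of_real pi * z)) * (of_real pi * cot (of_real pi * z))) (at z)"
    using s by (auto intro!: derivative_eq_intros simp: cot_def power2_eq_square)
  ultimately have "Gamma z * Gamma (1 - z) * (Digamma z - Digamma (1 - z)) =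
      - (of_real pi / sin (of_real pi * z)) * (of_real pi * cot (of_real pi * z))"
    unfolding Gamma_reflection_complex by (rule DERIV_unique)
  then have "of_real pi / sin (of_real pi * z) * (Digamma z - Digamma (1 - z)) =
      of_real pi / sin (of_real pi * z) * - (of_real pi * cot (of_real pi * z))"
    unfolding Gamma_reflection_complex by simp
  then have "Digamma z - Digamma (1 - z) = - (of_real pi * cot (of_real pi * z))"
    using s by (subst (asm) mult_left_cancel) auto
  then show ?thesis by (simp add: algebra_simps)
qed

lemma Polygamma_reflection:
  fixes z :: complex
  assumes z: "z \<notin> \<int>"
  shows "(-1) ^ n * Polygamma n (1 - z) - Polygamma n z =
    of_real pi * \<i> * (\<i> * of_real pi) ^ n * rpoly (cot_poly n) (- \<i> * cot (of_real pi * z))"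
  using z
proof (induction n arbitrary: z)
  case 0
  then show ?case by (simp add: Digamma_reflection rat_ev.ev_monom mult.assoc)
next
  case (Suc n)
  have z': "1 - z \<notin> \<int>" using Suc.prems Ints_diff[of 1 "1 - z"] by auto
  have np: "z \<notin> \<int>\<^sub>\<le>\<^sub>0" "1 - z \<notin> \<int>\<^sub>\<le>\<^sub>0" using Suc.prems z' nonpos_Ints_subset_Ints by blast+
  let ?u = "\<lambda>z. - \<i> * cot (of_real pi * z)"
  let ?L = "\<lambda>z. (-1) ^ n * Polygamma n (1 - z) - Polygamma n z"
  let ?R = "\<lambda>z. of_real pi * \<i> * (\<i> * of_real pi) ^ n * rpoly (cot_poly n) (?u z)"
  have L: "(?L has_field_derivative ((-1) ^ n * - Polygamma (Suc n) (1 - z) - Polygamma (Suc n) z)) (at z)"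
    using np by (auto intro!: derivative_eq_intros DERIV_chain2[OF has_field_derivative_Polygamma])
  have "(?R has_field_derivative of_real pi * \<i> * (\<i> * of_real pi) ^ n *
      (rpoly (pderiv (cot_poly n)) (?u z) * (\<i> * of_real pi * (1 - (?u z)\<^sup>2)))) (at z)"
    by (intro DERIV_cmult DERIV_chain2[OF rpoly_has_field_derivative]
        has_field_derivative_i_cot Suc.prems)
  \<comment> \<open>Differentiating the induction hypothesis requires it on a whole neighbourhood of
    z.\<close>
  moreover have "eventually (\<lambda>w. w \<in> - \<int>) (nhds z)"
    using Suc.prems by (intro eventually_nhds_in_open open_Compl_Ints) auto
  then have "eventually (\<lambda>w. ?L w = ?R w) (nhds z)"
    by eventually_elim (use Suc.IH in auto)
  ultimately have "(?L has_field_derivative of_real pi * \<i> * (\<i> * of_real pi) ^ n *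
      (rpoly (pderiv (cot_poly n)) (?u z) * (\<i> * of_real pi * (1 - (?u z)\<^sup>2)))) (at z)"
    by (subst DERIV_cong_ev[OF refl _ refl]) auto
  from DERIV_unique[OF L this] show ?case
    by (simp add: rat_ev.ev_mult rat_ev.ev_diff rat_ev.ev_monom rat_ev.ev_def[of 1] mult_ac)
qed

text \<open>If w \<noteq> 1 and w^n = 1, the right-hand side collapses to n, so that 1 / (w - 1)
  becomes a polynomial in w.\<close>

lemma sum_of_nat_mult_power:
  fixes w :: "'a::comm_ring_1"
  shows "(\<Sum>j<n. of_nat j * w ^ j) * (w - 1) = of_nat n * w ^ n - (\<Sum>j<n. w ^ j) * w"
  by (induction n) (simp_all add: algebra_simps)

text \<open>The same polynomial serves all q-th roots of unity except 1, so conjugation moves only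
  the point of evaluation.\<close>

lemma i_cot_root_of_unity_poly:
  assumes q: "q > 0"
  obtains C :: "rat poly" where "\<And>w. w ^ q = 1 \<Longrightarrow> w \<noteq> 1 \<Longrightarrow> rpoly C w = (w + 1) / (w - 1)"
proof
  fix w :: complex assume w: "w ^ q = 1" "w \<noteq> 1"
  have "(\<Sum>j<q. of_nat j * w ^ j) * (w - 1) = of_nat q"
    using w by (simp add: sum_of_nat_mult_power sum_gp_strict)
  then have "(\<Sum>j<q. of_nat j * w ^ j) = of_nat q / (w - 1)"
    using w by (simp add: field_simps)
  then show "rpoly ([:1, 1:] * smult (1 / of_nat q) (\<Sum>j<q. monom (of_nat j) j)) w = (w + 1) / (w - 1)"
    using q by (subst rat_ev.ev_mult) (simp add: rat_ev.ev_smult rat_ev.ev_sum rat_ev.ev_monom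
        rat_ev.ev_pCons of_rat_divide field_simps)
qed

text \<open>Numerator and denominator share the half-angle factor \<open>cis (pi * x)\<close>; what
  is left is twice the cosine and 2 \<open>\<i>\<close> times the sine.\<close>

lemma minus_i_cot_eq:
  fixes x :: real
  assumes "x \<notin> \<int>"
  shows "- \<i> * cot (of_real pi * of_real x) = (cis (2 * pi * x) + 1) / (cis (2 * pi * x) - 1)"
    and "cis (2 * pi * x) \<noteq> 1"
proof -
  have s: "sin (pi * x) \<noteq> 0"
    using assms by (auto simp: sin_zero_iff_int2 mult.commute[of pi])
  have "cis (2 * pi * x) = cis (pi * x) * cis (pi * x)" by (simp add: cis_mult algebra_simps)
  moreover have c: "cis (pi * x) * cis (- (pi * x)) = 1" by (simp add: cis_mult)
  moreover have sn: "cis (pi * x) - cis (- (pi * x)) = 2 * \<i> * of_real (sin (pi * x))"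
    "cis (pi * x) + cis (- (pi * x)) = 2 * of_real (cos (pi * x))"
    by (auto simp: complex_eq_iff)
  ultimately have e: "cis (2 * pi * x) - 1 = cis (pi * x) * (2 * \<i> * of_real (sin (pi * x)))"
    "cis (2 * pi * x) + 1 = cis (pi * x) * (2 * of_real (cos (pi * x)))"
    by (simp_all flip: sn add: algebra_simps)
  show "cis (2 * pi * x) \<noteq> 1" using e(1) s by auto
  show "- \<i> * cot (of_real pi * of_real x) = (cis (2 * pi * x) + 1) / (cis (2 * pi * x) - 1)"
    unfolding e using s
    by (simp add: cot_def sin_of_real cos_of_real field_simps flip: of_real_mult)
qed

section \<open>Subsums of the zeta series\<close>

text \<open>An unordered sum lets residue classes and sets of multiples be split and reindexed
  freely. For k > 0 the index 0 contributes 1 / 0 = 0, so \<open>UNIV\<close> yields \<zeta>(k) when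
  k > 1.\<close>

definition nat_zeta :: "nat \<Rightarrow> nat set \<Rightarrow> real" where
  "nat_zeta k A = (\<Sum>\<^sub>\<infinity>n\<in>A. 1 / real n ^ k)"

lemma nat_zeta_summable:
  assumes "k > 1"
  shows "(\<lambda>n. 1 / real n ^ k) summable_on A"
proof -
  have "summable (\<lambda>n. norm (1 / real n ^ k))"
    using inverse_power_summable[of k, where 'a = real] assms by (simp add: inverse_eq_divide)
  then have "(\<lambda>n. 1 / real n ^ k) summable_on UNIV"
    by (rule norm_summable_imp_summable_on)
  then show ?thesis by (rule summable_on_subset_banach) auto
qed

lemma nat_zeta_mono:
  assumes "k > 1" "A \<subseteq> B"
  shows "nat_zeta k A \<le> nat_zeta k B"
  unfolding nat_zeta_def by (intro infsum_mono2 nat_zeta_summable assms) auto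

lemma nat_zeta_insert:
  assumes "k > 1" "n \<notin> A"
  shows "nat_zeta k (insert n A) = 1 / real n ^ k + nat_zeta k A"
proof -
  have "insert n A = {n} \<union> A" by simp
  then show ?thesis unfolding nat_zeta_def using assms
    by (simp only:) (subst infsum_Un_disjoint, auto intro: nat_zeta_summable)
qed

lemma nat_zeta_UN:
  assumes "k > 1" "finite I" "disjoint_family_on A I"
  shows "nat_zeta k (\<Union>i\<in>I. A i) = (\<Sum>i\<in>I. nat_zeta k (A i))"
  using assms(2,3)
proof (induction I rule: finite_induct)
  case (insert i I)
  have "A i \<inter> (\<Union>j\<in>I. A j) = {}"
    using insert.hyps insert.prems by (fastforce simp: disjoint_family_on_def)
  then have "nat_zeta k (A i \<union> (\<Union>j\<in>I. A j)) = nat_zeta k (A i) + nat_zeta k (\<Union>j\<in>I. A j)"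
    unfolding nat_zeta_def using assms(1) by (intro infsum_Un_disjoint nat_zeta_summable)
  moreover have "disjoint_family_on A I" using insert.prems by (auto simp: disjoint_family_on_def)
  ultimately show ?case using insert by simp
qed (simp add: nat_zeta_def)

lemma nat_zeta_mult_image:
  assumes "p > 0"
  shows "nat_zeta k ((*) p ` A) = 1 / real p ^ k * nat_zeta k A"
proof -
  have "nat_zeta k ((*) p ` A) = infsum ((\<lambda>n. 1 / real n ^ k) \<circ> (*) p) A"
    unfolding nat_zeta_def using assms by (intro infsum_reindex) (auto simp: inj_on_def)
  also have "(\<lambda>n. 1 / real n ^ k) \<circ> (*) p = (\<lambda>n. 1 / real p ^ k * (1 / real n ^ k))"
    by (auto simp: power_mult_distrib)
  finally show ?thesis unfolding nat_zeta_def by (simp only: infsum_cmult_right')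
qed

text \<open>Each removed prime p multiplies the sum by its Euler factor 1 - p^(-k), a positive
  rational.\<close>

lemma nat_zeta_remove_primes:
  assumes k: "k > 1" and "finite S" "\<forall>p\<in>S. prime p"
  shows "\<exists>r::rat. r > 0 \<and> nat_zeta k {n. \<forall>p\<in>S. \<not> p dvd n} = of_rat r * nat_zeta k UNIV"
  using assms(2,3)
proof (induction S rule: finite_induct)
  case empty
  show ?case by (intro exI[of _ 1]) simp
next
  case (insert p S)
  then obtain r where r: "r > 0"
    "nat_zeta k {n. \<forall>p\<in>S. \<not> p dvd n} = of_rat r * nat_zeta k UNIV" by auto
  let ?A = "{n. \<forall>p\<in>S. \<not> p dvd n}"
  have p: "prime p" using insert.prems by simp
  then have p1: "p > 1" by (rule prime_gt_1_nat)
  have ndvd: "\<not> r dvd p" if "r \<in> S" for r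
    using that insert.hyps insert.prems primes_dvd_imp_eq[of r p] by auto
  \<comment> \<open>The multiples of p are split off: no prime of \<open>S\<close> divides p, so p m
    avoids \<open>S\<close> exactly when m does.\<close>
  have "?A = (*) p ` ?A \<union> {n. \<forall>p\<in>insert p S. \<not> p dvd n}"
  proof (intro equalityI subsetI)
    fix n assume n: "n \<in> ?A"
    show "n \<in> (*) p ` ?A \<union> {n. \<forall>p\<in>insert p S. \<not> p dvd n}"
    proof (cases "p dvd n")
      case True
      then obtain m where "n = p * m" by (auto elim: dvdE)
      with n have "m \<in> ?A" by auto
      then show ?thesis using \<open>n = p * m\<close> by blast
    qed (use n in auto)
  next
    fix n assume "n \<in> (*) p ` ?A \<union> {n. \<forall>p\<in>insert p S. \<not> p dvd n}"
    then show "n \<in> ?A"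
      using insert.prems ndvd by (auto simp: prime_dvd_mult_iff)
  qed
  then have "nat_zeta k ?A = nat_zeta k ((*) p ` ?A \<union> {n. \<forall>p\<in>insert p S. \<not> p dvd n})"
    by simp
  also have "\<dots> = nat_zeta k ((*) p ` ?A) + nat_zeta k {n. \<forall>p\<in>insert p S. \<not> p dvd n}"
    unfolding nat_zeta_def by (intro infsum_Un_disjoint nat_zeta_summable k) auto
  also have "nat_zeta k ((*) p ` ?A) = 1 / real p ^ k * nat_zeta k ?A"
    using p1 by (intro nat_zeta_mult_image) auto
  finally have "nat_zeta k {n. \<forall>p\<in>insert p S. \<not> p dvd n} = (1 - 1 / real p ^ k) * nat_zeta k ?A"
    by (simp add: left_diff_distrib)
  also have "\<dots> = of_rat ((1 - 1 / of_nat p ^ k) * r) * nat_zeta k UNIV"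
    by (simp add: r of_rat_mult of_rat_diff of_rat_divide of_rat_power)
  finally have "nat_zeta k {n. \<forall>p\<in>insert p S. \<not> p dvd n} =
    of_rat ((1 - 1 / of_nat p ^ k) * r) * nat_zeta k UNIV" .
  moreover have "(1 - 1 / of_nat p ^ k) * r > (0 :: rat)"
    using r p1 k by (intro mult_pos_pos) (auto simp: one_less_power)
  ultimately show ?case by blast
qed

corollary nat_zeta_coprime:
  assumes "k > 1" "q > 0"
  shows "\<exists>r::rat. r > 0 \<and> nat_zeta k {n. coprime n q} = of_rat r * nat_zeta k UNIV"
proof -
  have "coprime n q \<longleftrightarrow> (\<forall>p\<in>prime_factors q. \<not> p dvd n)" for n
    using assms(2) by (metis coprime_commute coprime_iff_gcd_eq_1 in_prime_factors_iff not_prime_unit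
        coprime_common_divisor prime_factor_nat gcd_nat.boundedE neq0_conv)
  then show ?thesis using nat_zeta_remove_primes[OF assms(1), of "prime_factors q"] by auto
qed

text \<open>The worst case is k = 2, where the sum is \<pi>^2 / 6 - 1; the bound \<pi> < 3.2
  suffices.\<close>

lemma nat_zeta_from_2_less_1:
  assumes "k > 1"
  shows "nat_zeta k {2..} < 1"
proof -
  have "nat_zeta k {2..} \<le> nat_zeta 2 {2..}"
    unfolding nat_zeta_def using assms
    by (intro infsum_mono nat_zeta_summable) (auto intro!: divide_left_mono power_increasing)
  also have "nat_zeta 2 {2..} = nat_zeta 2 (range Suc) - 1"
  proof -
    have "range Suc = insert 1 {2..}"
      by (auto simp: image_iff) (metis Suc_le_D numeral_2_eq_2)
    then show ?thesis by (simp add: nat_zeta_insert)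
  qed
  also have "nat_zeta 2 (range Suc) = pi\<^sup>2 / 6"
  proof -
    have "nat_zeta 2 (range Suc) = infsum ((\<lambda>n. 1 / real n ^ 2) \<circ> Suc) UNIV"
      unfolding nat_zeta_def by (intro infsum_reindex) auto
    moreover have "(((\<lambda>n. 1 / real n ^ 2) \<circ> Suc) has_sum (pi\<^sup>2 / 6)) UNIV"
      using inverse_squares_sums by (intro sums_nonneg_imp_has_sum) (auto simp: o_def add.commute)
    ultimately show ?thesis by (simp add: infsumI)
  qed
  also have "pi\<^sup>2 / 6 - 1 < 1"
  proof -
    have "pi\<^sup>2 < (32/10)\<^sup>2" using pi_approx by (intro power_strict_mono) auto
    then show ?thesis by (simp add: power2_eq_square)
  qed
  finally show ?thesis .
qed

section \<open>Hurwitz values through Polygamma functions and through residue classes\<close>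

lemma hurwitz_zeta_term:
  assumes "x > 0"
  shows "complex_of_real (real n + x) powr (- of_nat k) = inverse ((of_real x + of_nat n) ^ k)"
proof -
  have "complex_of_real (real n + x) \<noteq> 0" using assms by (simp only: of_real_eq_0_iff)
  then show ?thesis by (simp add: powr_minus powr_nat' add.commute)
qed

lemma hurwitz_zeta_Polygamma:
  assumes "k > 1" "x > 0"
  shows "hurwitz_zeta (of_nat k) x = (-1) ^ k * Polygamma (k - 1) (of_real x) / fact (k - 1)"
proof -
  have "hurwitz_zeta (of_nat k) x = (\<Sum>n. inverse ((of_real x + of_nat n) ^ k))"
    unfolding hurwitz_zeta_def by (simp only: hurwitz_zeta_term[OF assms(2)])
  then show ?thesis
    using Polygamma_LIMSEQ[of "complex_of_real x" "k - 1"] assms by (simp add: sums_iff)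
qed

text \<open>This form carries the size estimates, the one with \<open>Polygamma\<close> the
  arithmetic.\<close>

lemma hurwitz_zeta_nat_zeta:
  assumes k: "k > 1" and a: "0 < a" "a < q"
  shows "hurwitz_zeta (of_nat k) (real a / real q) = of_real (real q ^ k * nat_zeta k {n. n mod q = a})"
proof -
  have "{n. n mod q = a} = range (\<lambda>m. m * q + a)"
  proof (intro equalityI subsetI)
    fix n assume "n \<in> {n. n mod q = a}"
    then have "n = (n div q) * q + a" by auto
    then show "n \<in> range (\<lambda>m. m * q + a)" by blast
  qed (use a in auto)
  then have "((\<lambda>n. 1 / real n ^ k) has_sum nat_zeta k {n. n mod q = a}) (range (\<lambda>m. m * q + a))"
    using nat_zeta_summable[OF k] by (simp add: nat_zeta_def has_sum_infsum)
  then have "((\<lambda>m. 1 / real (m * q + a) ^ k) has_sum nat_zeta k {n. n mod q = a}) UNIV"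
    using a by (subst (asm) has_sum_reindex) (auto simp: inj_on_def o_def)
  then have "(\<lambda>m. real q ^ k * (1 / real (m * q + a) ^ k)) sums (real q ^ k * nat_zeta k {n. n mod q = a})"
    by (intro sums_mult has_sum_imp_sums)
  then have "(\<lambda>m. complex_of_real (real q ^ k * (1 / real (m * q + a) ^ k)))
      sums of_real (real q ^ k * nat_zeta k {n. n mod q = a})"
    by (rule sums_of_real)
  moreover have "complex_of_real (real q ^ k * (1 / real (m * q + a) ^ k)) =
      complex_of_real (real m + real a / real q) powr (- of_nat k)" for m
  proof -
    have "real m + real a / real q = real (m * q + a) / real q"
      using a by (simp add: field_simps)
    then have "real q ^ k * (1 / real (m * q + a) ^ k) = inverse ((real a / real q + real m) ^ k)"
      by (simp add: power_divide add.commute inverse_eq_divide)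
    then show ?thesis using a by (subst hurwitz_zeta_term) auto
  qed
  ultimately show ?thesis by (simp add: hurwitz_zeta_def sums_iff)
qed

section \<open>The odd part of the Hurwitz space\<close>

definition scaled_hurwitz :: "nat \<Rightarrow> nat \<Rightarrow> nat \<Rightarrow> complex" where
  "scaled_hurwitz k q a = hurwitz_zeta (of_nat k) (real a / real q) / of_real pi ^ k"

definition hurwitz_odd :: "nat \<Rightarrow> nat \<Rightarrow> nat \<Rightarrow> complex" where
  "hurwitz_odd k q a = scaled_hurwitz k q a - scaled_hurwitz k q (q - a)"

lemma scaled_hurwitz_nat_zeta:
  assumes "k > 1" "0 < a" "a < q"
  shows "scaled_hurwitz k q a = of_real ((real q / pi) ^ k * nat_zeta k {n. n mod q = a})"
  using hurwitz_zeta_nat_zeta[OF assms] by (simp add: scaled_hurwitz_def power_divide)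

lemma hurwitz_odd_reflect: "a \<le> q \<Longrightarrow> hurwitz_odd k q (q - a) = - hurwitz_odd k q a"
  by (simp add: hurwitz_odd_def)

lemma cis_root_power: "q > 0 \<Longrightarrow> cis (2 * pi / real q) ^ q = 1"
  by (simp add: Complex.DeMoivre)

text \<open>Since k - 1 is even, the left side of the reflection formula is a difference of
  Polygamma values, and the powers of \<pi> cancel up to a rational sign and one factor
  \<open>\<i>\<close>. As P is the same for all a, replacing the root of unity by its t-th power
  turns index a into a t modulo q.\<close>

lemma hurwitz_odd_poly:
  assumes k: "k > 1" "odd k" and q: "q > 0"
  shows "\<exists>P. \<forall>a. 0 < a \<and> a < q \<longrightarrow> hurwitz_odd k q a = \<i> * rpoly P (cis (2 * pi / real q) ^ a)"
proof -
  obtain C :: "rat poly" where C: "\<And>w. w ^ q = 1 \<Longrightarrow> w \<noteq> 1 \<Longrightarrow> rpoly C w = (w + 1) / (w - 1)"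
    using i_cot_root_of_unity_poly[OF q] by blast
  define n where "n = k - 1"
  have n: "even n" "k = Suc n" using k by (auto simp: n_def)
  have i_n: "(\<i> * of_real pi) ^ n = (-1) ^ (n div 2) * complex_of_real pi ^ n"
    using n(1) by (auto elim!: evenE simp: power_mult power_mult_distrib)
  have fact_n: "complex_of_rat (fact n) = fact n" by (metis of_nat_fact of_rat_of_nat_eq)
  \<comment> \<open>The sign comes from the even power of \<open>\<i>\<close>, the factorial from
    the Polygamma series.\<close>
  define P where "P = smult ((-1) ^ (n div 2) / fact n) (pcompose (cot_poly n) C)"
  have "hurwitz_odd k q a = \<i> * rpoly P (cis (2 * pi / real q) ^ a)" if a: "0 < a" "a < q" for a
  proof -
    define x where "x = real a / real q"
    have x: "0 < x" "x < 1" using a by (auto simp: x_def)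
    have xi: "x \<notin> \<int>" using x by (auto elim!: Ints_cases)
    have xc: "complex_of_real x \<notin> \<int>" using xi by (metis Ints_cases Ints_of_int of_real_eq_iff of_real_of_int_eq)
    have qa: "real (q - a) / real q = 1 - x" using a by (simp add: x_def of_nat_diff field_simps)
    have w: "cis (2 * pi / real q) ^ a = cis (2 * pi * x)"
      by (simp add: Complex.DeMoivre x_def field_simps)
    have "cis (2 * pi * x) ^ q = (cis (2 * pi / real q) ^ q) ^ a"
      unfolding w[symmetric] by (simp flip: power_mult add: mult.commute)
    then have "cis (2 * pi * x) ^ q = 1" using cis_root_power[OF q] by simp
    then have u: "rpoly C (cis (2 * pi * x)) = - \<i> * cot (of_real pi * of_real x)"
      using minus_i_cot_eq[OF xi] C by metis
    have h: "hurwitz_zeta (of_nat k) y = - Polygamma n (of_real y) / fact n" if "y > 0" for y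
      using hurwitz_zeta_Polygamma[OF k(1) that] k(2) by (simp add: n_def)
    have "hurwitz_zeta (of_nat k) x - hurwitz_zeta (of_nat k) (1 - x) =
        ((-1) ^ n * Polygamma n (1 - complex_of_real x) - Polygamma n (complex_of_real x)) / fact n"
      using h[of x] h[of "1 - x"] n(1) x by (simp add: diff_divide_distrib)
    also have "\<dots> = of_real pi * \<i> * (\<i> * of_real pi) ^ n
        * rpoly (cot_poly n) (- \<i> * cot (of_real pi * of_real x)) / fact n"
      by (simp only: Polygamma_reflection[OF xc])
    also have "\<dots> = of_real pi ^ k * (\<i> * rpoly P (cis (2 * pi * x)))"
      by (simp add: P_def rat_ev.ev_smult rat_ev.ev_pcompose u i_n n(2) of_rat_divide of_rat_power
          of_rat_minus fact_n)
    finally have "hurwitz_zeta (of_nat k) x - hurwitz_zeta (of_nat k) (1 - x) =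
      of_real pi ^ k * (\<i> * rpoly P (cis (2 * pi * x)))" .
    then show ?thesis
      unfolding hurwitz_odd_def scaled_hurwitz_def qa w x_def[symmetric]
        diff_divide_distrib[symmetric] by simp
  qed
  then show ?thesis by blast
qed

section \<open>Units modulo q and relations between the odd values\<close>

definition units_below :: "nat \<Rightarrow> nat set" where
  "units_below q = {a. 1 \<le> a \<and> a < q \<and> coprime a q}"

lemma finite_units_below [simp]: "finite (units_below q)"
  by (rule finite_subset[of _ "{..<q}"]) (auto simp: units_below_def)

lemma hurwitz_space_eq: "hurwitz_space k q = rat_vs.span (scaled_hurwitz k q ` units_below q)"
  unfolding hurwitz_space_def scaled_hurwitz_def units_below_def
  by (rule arg_cong[of _ _ rat_vs.span]) auto

lemma units_below_mod:
  assumes "q > 1" "coprime n q"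
  shows "n mod q \<in> units_below q"
proof -
  have "coprime (n mod q) q" using assms by simp
  moreover from this have "n mod q \<noteq> 0" using assms(1) by (metis coprime_0_left_iff less_irrefl nat_dvd_1_iff_1)
  ultimately show ?thesis using assms(1) by (simp add: units_below_def)
qed

lemma units_below_reflect: "q > 1 \<Longrightarrow> a \<in> units_below q \<Longrightarrow> q - a \<in> units_below q"
  by (auto simp: units_below_def coprime_diff_one_left_nat)
    (metis coprime_commute coprime_iff_gcd_eq_1 gcd_diff2_nat less_imp_le)

lemma of_rat_complex: "complex_of_real (of_rat r) = of_rat r"
  by (cases r) (simp add: Fract_of_int_quotient of_rat_divide)

lemma root_of_unity_power_mod:
  fixes z :: "'a::monoid_mult"
  assumes "z ^ N = 1"
  shows "z ^ (n mod N) = z ^ n"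
proof -
  have "z ^ n = z ^ (N * (n div N) + n mod N)" by simp
  also have "\<dots> = z ^ (n mod N)" by (simp only: power_add power_mult assms) simp
  finally show ?thesis ..
qed

text \<open>Multiplication by t commutes with negation modulo q. For residue 0 the right-hand side
  would be q instead of 0.\<close>

lemma reflect_mult_mod:
  fixes a t q :: nat
  assumes "a \<le> q" "(a * t) mod q \<noteq> 0"
  shows "((q - a) * t) mod q = q - (a * t) mod q"
proof -
  \<comment> \<open>From a t = q d + m with m > 0 follows d < t, so q t - a t = q (t - d - 1) + (q -
    m) stays within the natural numbers.\<close>
  define m d where "m = (a * t) mod q" and "d = (a * t) div q"
  have at: "a * t = q * d + m" by (simp add: m_def d_def)
  have m: "0 < m" using assms(2) by (simp add: m_def)
  have "m < q" using assms by (cases "q = 0") (auto simp: m_def)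
  have "q * d < q * t" using mult_le_mono1[OF assms(1), of t] at m by linarith
  then have "d < t" by simp
  then obtain e where t: "t = d + 1 + e" using less_iff_Suc_add by auto
  have "(q - a) * t = q * t - a * t" by (simp add: diff_mult_distrib)
  also have "\<dots> = q * (d + 1 + e) - (q * d + m)" by (simp only: at) (simp only: t)
  also have "\<dots> = q * e + (q - m)" using \<open>m < q\<close> by (simp add: algebra_simps)
  finally have "((q - a) * t) mod q = (q - m) mod q" by (simp only: mod_mult_self4)
  then show ?thesis using \<open>m < q\<close> m by (simp add: m_def)
qed

text \<open>Okada's theorem. Conjugation turns one relation into a relation for each unit \<open>t\<close> modulo \<open>q\<close>.
  When \<open>t\<close> inverts the index of the largest coefficient, that coefficient is multiplied by
  \<open>\<Sum>n \<equiv> 1. 1 / n ^ k \<ge> 1\<close>, whereas the other weights sum up to at most \<open>\<zeta>(k) - 1 < 1\<close>.\<close>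

lemma hurwitz_odd_relation_trivial:
  fixes c :: "nat \<Rightarrow> rat"
  assumes k: "k > 1" "odd k" and q: "q > 2"
    and c_odd: "\<And>a. a \<in> units_below q \<Longrightarrow> c (q - a) = - c a"
    and rel: "(\<Sum>a\<in>units_below q. of_rat (c a) * hurwitz_odd k q a) = 0"
    and a: "a \<in> units_below q"
  shows "c a = 0"
proof (rule ccontr)
  assume ca: "c a \<noteq> 0"
  let ?U = "units_below q" and ?\<zeta> = "cis (2 * pi / real q)"
  have \<zeta>: "?\<zeta> ^ q = 1" using q by (intro cis_root_power) auto
  obtain P where P: "\<And>a. 0 < a \<Longrightarrow> a < q \<Longrightarrow> hurwitz_odd k q a = \<i> * rpoly P (?\<zeta> ^ a)"
    using hurwitz_odd_poly[OF k, of q] q by auto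
  \<comment> \<open>By \<open>hurwitz_odd_poly\<close> the given relation says that this polynomial
    vanishes at the root of unity.\<close>
  define Q where "Q = (\<Sum>a\<in>?U. smult (c a) (pcompose P (monom 1 a)))"
  have Q: "rpoly Q x = (\<Sum>a\<in>?U. of_rat (c a) * rpoly P (x ^ a))" for x
    by (simp add: Q_def rat_ev.ev_sum rat_ev.ev_smult rat_ev.ev_pcompose rat_ev.ev_monom)
  have Ud: "0 < a \<and> a < q" if "a \<in> ?U" for a using that by (auto simp: units_below_def)
  have modU: "(a * t) mod q \<in> ?U" if "a \<in> ?U" "coprime t q" for a t
    using that q by (intro units_below_mod) (auto simp: units_below_def)
  have "\<i> * rpoly Q ?\<zeta> = 0"
    using rel by (simp add: Q sum_distrib_left P Ud mult.left_commute cong: sum.cong)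
  then have Q0: "rpoly Q ?\<zeta> = 0" by simp
  have rel1: "(\<Sum>a\<in>?U. of_rat (c a) * hurwitz_odd k q ((a * t) mod q)) = 0" if t: "coprime t q" for t
  proof -
    have "rpoly Q (?\<zeta> ^ t) = 0"
      using q \<zeta> t Q0 by (intro rpoly_root_of_unity_conjugate[of q]) auto
    then have "(\<Sum>a\<in>?U. of_rat (c a) * (\<i> * rpoly P (?\<zeta> ^ (a * t)))) = 0"
      by (simp add: Q mult.left_commute mult.commute[of t] flip: power_mult sum_distrib_left)
    moreover have "hurwitz_odd k q ((a * t) mod q) = \<i> * rpoly P (?\<zeta> ^ (a * t))" if "a \<in> ?U" for a
      using P[of "(a * t) mod q"] Ud[OF modU[OF that t]] root_of_unity_power_mod[OF \<zeta>] by simp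
    ultimately show ?thesis by simp
  qed
  \<comment> \<open>As c is odd, the substitution a -> q - a turns the subtracted halves into a
    second copy of the sum. What remains is a relation between nonnegative real numbers, which can
    be estimated.\<close>
  have rel2: "(\<Sum>a\<in>?U. of_rat (c a) * nat_zeta k {n. n mod q = (a * t) mod q}) = 0"
    if t: "coprime t q" for t
  proof -
    let ?Z = "\<lambda>a. scaled_hurwitz k q a"
    have qq: "q - (q - a) = a" if "a \<in> ?U" for a using Ud[OF that] by simp
    have "(\<Sum>a\<in>?U. of_rat (c a) * ?Z (q - (a * t) mod q)) =
        (\<Sum>a\<in>?U. of_rat (c (q - a)) * ?Z (q - ((q - a) * t) mod q))"
      using q by (intro sum.reindex_bij_witness[of _ "\<lambda>a. q - a" "\<lambda>a. q - a"])
        (auto simp: units_below_reflect qq)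
    also have "\<dots> = (\<Sum>a\<in>?U. - (of_rat (c a) * ?Z ((a * t) mod q)))"
    proof (rule sum.cong)
      fix a assume a: "a \<in> ?U"
      have "((q - a) * t) mod q = q - (a * t) mod q"
        using Ud[OF a] Ud[OF modU[OF a t]] by (intro reflect_mult_mod) auto
      then show "of_rat (c (q - a)) * ?Z (q - ((q - a) * t) mod q) = - (of_rat (c a) * ?Z ((a * t) mod q))"
        using Ud[OF modU[OF a t]] by (simp add: c_odd[OF a] of_rat_minus)
    qed simp
    finally have "2 * (\<Sum>a\<in>?U. of_rat (c a) * ?Z ((a * t) mod q)) = 0"
      using rel1[OF t] by (simp add: hurwitz_odd_def right_diff_distrib sum_subtractf sum_negf)
    then have "(\<Sum>a\<in>?U. of_rat (c a) * ?Z ((a * t) mod q)) = 0" by simp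
    moreover have "(\<Sum>a\<in>?U. of_rat (c a) * ?Z ((a * t) mod q)) =
      of_real ((real q / pi) ^ k * (\<Sum>a\<in>?U. of_rat (c a) * nat_zeta k {n. n mod q = (a * t) mod q}))"
      using k Ud[OF modU[OF _ t]]
      by (simp add: scaled_hurwitz_nat_zeta sum_distrib_left mult.left_commute of_rat_complex)
    ultimately show ?thesis using q by (simp only: of_real_eq_0_iff) simp
  qed
  let ?M = "Max ((\<lambda>x. \<bar>c x\<bar>) ` ?U)"
  have "?M \<in> (\<lambda>x. \<bar>c x\<bar>) ` ?U" using a by (intro Max_in) auto
  then obtain b where b1: "b \<in> ?U" "?M = \<bar>c b\<bar>" by blast
  have "\<bar>c x\<bar> \<le> ?M" if "x \<in> ?U" for x using that by (intro Max_ge) auto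
  then have b: "b \<in> ?U" "\<And>x. x \<in> ?U \<Longrightarrow> \<bar>c x\<bar> \<le> \<bar>c b\<bar>" using b1 by auto
  have cb: "\<bar>c b\<bar> > 0" using b(2)[OF a] ca by simp
  \<comment> \<open>This t carries the index b of a largest coefficient to the class of 1, whose sum
    contains the term n = 1.\<close>
  obtain t where bt: "[b * t = 1] (mod q)"
    using b(1) by (auto simp: units_below_def coprime_iff_invertible_nat)
  then have t: "coprime t q"
    unfolding coprime_iff_invertible_nat by (intro exI[of _ b]) (simp add: mult.commute)
  let ?W = "\<lambda>a. {n. n mod q = (a * t) mod q}"
  have inj: "x = y" if "x \<in> ?U" "y \<in> ?U" "(x * t) mod q = (y * t) mod q" for x y
  proof -
    have "[x * t = y * t] (mod q)" using that(3) by (simp add: cong_def)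
    then have "[x = y] (mod q)" using cong_mult_rcancel_nat t by blast
    then show ?thesis using Ud[OF that(1)] Ud[OF that(2)] by (simp add: cong_def)
  qed
  have bt1: "(b * t) mod q = 1" using bt q by (simp add: cong_def)
  have "(\<Sum>a\<in>?U - {b}. nat_zeta k (?W a)) = nat_zeta k (\<Union>a\<in>?U - {b}. ?W a)"
    by (rule nat_zeta_UN[symmetric]) (use k inj in \<open>auto simp: disjoint_family_on_def\<close>)
  \<comment> \<open>The other indices go to classes different from those of 0 and 1, which contain
    no n below 2.\<close>
  also have "\<dots> \<le> nat_zeta k {2..}"
  proof (rule nat_zeta_mono[OF k(1)], rule subsetI)
    fix n assume "n \<in> (\<Union>a\<in>?U - {b}. ?W a)"
    then obtain x where x: "n mod q = x * t mod q" "x \<in> ?U" "x \<noteq> b" by auto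
    have "n mod q \<noteq> 1" using inj[OF x(2) b(1)] x bt1 by auto
    moreover have "n mod q \<noteq> 0" using Ud[OF modU[OF x(2) t]] x(1) by auto
    moreover have "n mod q \<le> n" by simp
    ultimately have "2 \<le> n" by linarith
    then show "n \<in> {2..}" by simp
  qed
  also have "\<dots> < 1" by (rule nat_zeta_from_2_less_1[OF k(1)])
  finally have small: "(\<Sum>a\<in>?U - {b}. nat_zeta k (?W a)) < 1" .
  have nonneg: "nat_zeta k A \<ge> 0" for A unfolding nat_zeta_def by (intro infsum_nonneg) auto
  have "nat_zeta k {1} \<le> nat_zeta k (?W b)"
    using bt1 q by (intro nat_zeta_mono k) auto
  then have big: "1 \<le> nat_zeta k (?W b)" by (simp add: nat_zeta_def)
  have "of_rat (c b) * nat_zeta k (?W b) = - (\<Sum>a\<in>?U - {b}. of_rat (c a) * nat_zeta k (?W a))"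
    using rel2[OF t] sum.remove[OF finite_units_below b(1), of "\<lambda>a. of_rat (c a) * nat_zeta k (?W a)"]
    by simp
  then have "\<bar>of_rat (c b) * nat_zeta k (?W b)\<bar> = \<bar>\<Sum>a\<in>?U - {b}. of_rat (c a) * nat_zeta k (?W a)\<bar>"
    by simp
  also have "\<dots> \<le> (\<Sum>a\<in>?U - {b}. \<bar>of_rat (c a) * nat_zeta k (?W a)\<bar>)" by (rule sum_abs)
  also have "\<dots> \<le> (\<Sum>a\<in>?U - {b}. of_rat \<bar>c b\<bar> * nat_zeta k (?W a))"
    by (intro sum_mono) (auto simp: abs_mult nonneg of_rat_less_eq b(2) abs_of_rat intro!: mult_right_mono)
  also have "\<dots> = of_rat \<bar>c b\<bar> * (\<Sum>a\<in>?U - {b}. nat_zeta k (?W a))" by (simp add: sum_distrib_left)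
  also have "\<dots> < of_rat \<bar>c b\<bar> * 1" using small cb by (intro mult_strict_left_mono) auto
  also have "\<dots> \<le> of_rat \<bar>c b\<bar> * nat_zeta k (?W b)" using big cb by (intro mult_left_mono) auto
  finally show False by (simp add: abs_mult nonneg abs_of_rat)
qed

section \<open>Independence over representatives of the units up to sign\<close>

definition lower_units :: "nat \<Rightarrow> nat set" where
  "lower_units q = {a \<in> units_below q. 2 * a < q}"

lemma finite_lower_units [simp]: "finite (lower_units q)"
  by (simp add: lower_units_def)

lemma units_below_split:
  assumes "q > 2"
  shows "units_below q = lower_units q \<union> (-) q ` lower_units q"
    and "lower_units q \<inter> (-) q ` lower_units q = {}" and "inj_on ((-) q) (lower_units q)"
proof -
  have "a \<in> (-) q ` lower_units q" if a: "a \<in> units_below q" "a \<notin> lower_units q" for a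
  proof -
    \<comment> \<open>A fixed point of a -> q - a would be a unit dividing q, hence 1, and q would
      be 2.\<close>
    have "2 * a \<noteq> q"
    proof
      assume "2 * a = q"
      then have "a dvd q" by auto
      then have "a = 1" using a(1) by (auto simp: units_below_def coprime_absorb_left)
      then show False using \<open>2 * a = q\<close> assms by simp
    qed
    then have "q - a \<in> lower_units q" "a = q - (q - a)"
      using a assms units_below_reflect[of q a] by (auto simp: lower_units_def units_below_def)
    then show ?thesis by blast
  qed
  then show "units_below q = lower_units q \<union> (-) q ` lower_units q"
    using assms units_below_reflect[of q] by (auto simp: lower_units_def)
  show "lower_units q \<inter> (-) q ` lower_units q = {}" by (auto simp: lower_units_def)
  show "inj_on ((-) q) (lower_units q)"
    by (auto simp: lower_units_def units_below_def inj_on_def)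
qed

lemma totient_eq_card_lower_units:
  assumes "q > 2"
  shows "totient q = 2 * card (lower_units q)"
proof -
  have "totatives q = units_below q"
    using assms by (auto simp: totatives_def units_below_def le_less)
  then have "totient q = card (units_below q)" by (simp add: totient_def)
  then show ?thesis
    using units_below_split[OF assms] by (simp add: card_Un_disjoint card_image)
qed

text \<open>Extending d to an odd function on all units merely doubles the relation, because
  \<open>hurwitz_odd\<close> is odd as well.\<close>

lemma hurwitz_odd_lower_relation_trivial:
  fixes d :: "nat \<Rightarrow> rat"
  assumes k: "k > 1" "odd k" and q: "q > 2"
    and rel: "(\<Sum>a\<in>lower_units q. of_rat (d a) * hurwitz_odd k q a) = 0"
    and a: "a \<in> lower_units q"
  shows "d a = 0"
proof -
  define c where "c a = (if 2 * a < q then d a else - d (q - a))" for a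
  have *: "c (q - a) = - d a" "c a = d a" "hurwitz_odd k q (q - a) = - hurwitz_odd k q a"
    if "a \<in> lower_units q" for a
    using that by (auto simp: c_def lower_units_def intro!: hurwitz_odd_reflect)
  have "(\<Sum>a\<in>units_below q. of_rat (c a) * hurwitz_odd k q a) =
      (\<Sum>a\<in>lower_units q. of_rat (c a) * hurwitz_odd k q a) +
      (\<Sum>a\<in>lower_units q. of_rat (c (q - a)) * hurwitz_odd k q (q - a))"
    using units_below_split[OF q] by (simp add: sum.union_disjoint sum.reindex)
  also have "\<dots> = 2 * (\<Sum>a\<in>lower_units q. of_rat (d a) * hurwitz_odd k q a)"
    by (simp add: * of_rat_minus cong: sum.cong)
  finally have "(\<Sum>a\<in>units_below q. of_rat (c a) * hurwitz_odd k q a) = 0" using rel by simp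
  moreover have "c (q - a) = - c a" if "a \<in> units_below q" for a
  proof -
    have "a \<in> lower_units q \<union> (-) q ` lower_units q"
      using that units_below_split(1)[OF q] by simp
    then consider "a \<in> lower_units q" | b where "b \<in> lower_units q" "a = q - b"
      by blast
    then show ?thesis
    proof cases
      case 2
      then have "q - a = b" by (simp add: lower_units_def)
      then show ?thesis using *[OF 2(1)] 2(2) by simp
    qed (simp add: *)
  qed
  moreover have "a \<in> units_below q" using a by (simp add: lower_units_def)
  ultimately have "c a = 0" by (intro hurwitz_odd_relation_trivial[OF k q, of c]) auto
  then show ?thesis using *(2)[OF a] by simp
qed

text \<open>Two equal values would give a relation with coefficients 1 and -1. Injectivity is what
  lets the image be counted by its indices.\<close>

lemma inj_on_hurwitz_odd:
  assumes k: "k > 1" "odd k" and q: "q > 2"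
  shows "inj_on (hurwitz_odd k q) (lower_units q)"
proof (rule inj_onI, rule ccontr)
  fix a b assume ab: "a \<in> lower_units q" "b \<in> lower_units q"
    and eq: "hurwitz_odd k q a = hurwitz_odd k q b" and ne: "a \<noteq> b"
  let ?d = "\<lambda>x. if x = a then 1 else if x = b then -1 else 0 :: rat"
  have "(\<Sum>x\<in>lower_units q. of_rat (?d x) * hurwitz_odd k q x) =
      (\<Sum>x\<in>{a, b}. of_rat (?d x) * hurwitz_odd k q x)"
    using ab by (intro sum.mono_neutral_right) auto
  also have "\<dots> = 0" using ne eq by (simp add: of_rat_minus)
  finally have "?d a = 0" using ab(1) by (rule hurwitz_odd_lower_relation_trivial[OF k q])
  then show False by simp
qed

lemma independent_hurwitz_odd:
  assumes k: "k > 1" "odd k" and q: "q > 2"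
  shows "rat_vs.independent (hurwitz_odd k q ` lower_units q)"
proof (rule rat_vs.independent_if_scalars_zero)
  fix f x assume sum0: "(\<Sum>x\<in>hurwitz_odd k q ` lower_units q. rat_scale (f x) x) = 0"
    and x: "x \<in> hurwitz_odd k q ` lower_units q"
  have "(\<Sum>a\<in>lower_units q. of_rat (f (hurwitz_odd k q a)) * hurwitz_odd k q a) = 0"
    using sum0 by (simp add: sum.reindex[OF inj_on_hurwitz_odd[OF k q]] rat_scale_def)
  then show "f x = 0"
    using x hurwitz_odd_lower_relation_trivial[OF k q, of "\<lambda>a. f (hurwitz_odd k q a)"] by auto
qed simp

section \<open>The zeta value, and its exclusion from the odd span for coprime moduli\<close>

definition scaled_zeta :: "nat \<Rightarrow> complex" where
  "scaled_zeta k = of_real (nat_zeta k UNIV / pi ^ k)"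

lemma scaled_zeta_nonzero:
  assumes "k > 1"
  shows "scaled_zeta k \<noteq> 0"
proof -
  have "nat_zeta k {1} \<le> nat_zeta k UNIV" by (rule nat_zeta_mono[OF assms]) simp
  then have "nat_zeta k UNIV \<ge> 1" by (simp add: nat_zeta_def)
  then show ?thesis by (simp add: scaled_zeta_def)
qed

text \<open>Adding up all classes prime to q gives the zeta sum without the Euler factors at the
  primes dividing q, and these are rational.\<close>

lemma scaled_zeta_in_hurwitz_space:
  assumes k: "k > 1" and q: "q > 2"
  shows "scaled_zeta k \<in> hurwitz_space k q"
proof -
  let ?U = "units_below q"
  obtain r :: rat where r: "r > 0" "nat_zeta k {n. coprime n q} = of_rat r * nat_zeta k UNIV"
    using nat_zeta_coprime[OF k, of q] q by auto
  have "{n. coprime n q} = (\<Union>a\<in>?U. {n. n mod q = a})"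
  proof -
    have "coprime n q" if "n mod q \<in> ?U" for n
      using that q by (simp add: units_below_def)
    then show ?thesis using units_below_mod[of q] q by auto
  qed
  then have "nat_zeta k {n. coprime n q} = (\<Sum>a\<in>?U. nat_zeta k {n. n mod q = a})"
    using nat_zeta_UN[OF k, of ?U "\<lambda>a. {n. n mod q = a}"] by (auto simp: disjoint_family_on_def)
  then have "(\<Sum>a\<in>?U. scaled_hurwitz k q a) = of_real ((real q / pi) ^ k * nat_zeta k {n. coprime n q})"
    using k by (simp add: scaled_hurwitz_nat_zeta units_below_def sum_distrib_left)
  also have "\<dots> = of_rat (of_nat q ^ k * r) * scaled_zeta k"
    by (simp add: r(2) scaled_zeta_def power_divide of_rat_mult of_rat_power of_rat_complex)
  finally have "scaled_zeta k = rat_scale (1 / (of_nat q ^ k * r)) (\<Sum>a\<in>?U. scaled_hurwitz k q a)"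
    using r(1) q by (simp add: rat_scale_def of_rat_divide)
  also have "\<dots> \<in> hurwitz_space k q"
    unfolding hurwitz_space_eq
    by (intro rat_vs.span_scale rat_vs.span_sum rat_vs.span_base) auto
  finally show ?thesis .
qed

text \<open>The exponent q - 1 inverts q-th roots of unity, thus exchanges a with q - a and changes
  the sign of each odd value. Pairing both evaluations of one P replaces the use of a field
  automorphism.\<close>

lemma span_hurwitz_odd_conjugate:
  assumes k: "k > 1" "odd k" and q: "q > 2"
    and z: "z \<in> rat_vs.span (hurwitz_odd k q ` lower_units q)"
  shows "\<exists>P. z = \<i> * rpoly P (cis (2 * pi / real q)) \<and>
    - z = \<i> * rpoly P (cis (2 * pi / real q) ^ (q - 1))"
proof -
  let ?\<zeta> = "cis (2 * pi / real q)"
  let ?T = "{z. \<exists>P. z = \<i> * rpoly P ?\<zeta> \<and> - z = \<i> * rpoly P (?\<zeta> ^ (q - 1))}"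
  have \<zeta>: "?\<zeta> ^ q = 1" using q by (intro cis_root_power) auto
  have "rat_vs.subspace ?T"
  proof (rule rat_vs.subspaceI)
    show "0 \<in> ?T" by (auto intro!: exI[of _ 0])
  next
    fix x y assume "x \<in> ?T" "y \<in> ?T"
    then obtain P Q where "x = \<i> * rpoly P ?\<zeta>" "- x = \<i> * rpoly P (?\<zeta> ^ (q - 1))"
      "y = \<i> * rpoly Q ?\<zeta>" "- y = \<i> * rpoly Q (?\<zeta> ^ (q - 1))" by blast
    then have "x + y = \<i> * rpoly (P + Q) ?\<zeta> \<and> - (x + y) = \<i> * rpoly (P + Q) (?\<zeta> ^ (q - 1))"
      by (simp only: rat_ev.ev_add distrib_left minus_add_distrib)
    then show "x + y \<in> ?T" by blast
  next
    fix c x assume "x \<in> ?T"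
    then obtain P where "x = \<i> * rpoly P ?\<zeta>" "- x = \<i> * rpoly P (?\<zeta> ^ (q - 1))" by blast
    then have "rat_scale c x = \<i> * rpoly (smult c P) ?\<zeta> \<and>
        - rat_scale c x = \<i> * rpoly (smult c P) (?\<zeta> ^ (q - 1))"
      by (simp only: rat_ev.ev_smult rat_scale_def mult.left_commute[of \<i>] mult_minus_right[symmetric])
    then show "rat_scale c x \<in> ?T" by blast
  qed
  moreover have "hurwitz_odd k q ` lower_units q \<subseteq> ?T"
  proof safe
    fix a assume "a \<in> lower_units q"
    then have a: "0 < a" "a < q" by (auto simp: lower_units_def units_below_def)
    obtain P where P: "\<And>a. 0 < a \<Longrightarrow> a < q \<Longrightarrow> hurwitz_odd k q a = \<i> * rpoly P (?\<zeta> ^ a)"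
      using hurwitz_odd_poly[OF k, of q] q by auto
    \<comment> \<open>This is the congruence of (q - 1) a and -a modulo q, written with natural
      numbers; a > 0 keeps a - 1 exact.\<close>
    have "(q - 1) * a = q * (a - 1) + (q - a)"
      using a by (cases a) (auto simp: algebra_simps)
    then have "?\<zeta> ^ ((q - 1) * a) = ?\<zeta> ^ (q - a)" by (simp only: power_add power_mult \<zeta>) simp
    then have "hurwitz_odd k q a = \<i> * rpoly (pcompose P (monom 1 a)) ?\<zeta> \<and>
        - hurwitz_odd k q a = \<i> * rpoly (pcompose P (monom 1 a)) (?\<zeta> ^ (q - 1))"
      using P[of a] P[of "q - a"] a hurwitz_odd_reflect[of a q k]
      by (simp add: rat_ev.ev_pcompose rat_ev.ev_monom flip: power_mult)
    then show "\<exists>P. hurwitz_odd k q a = \<i> * rpoly P ?\<zeta> \<and>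
        - hurwitz_odd k q a = \<i> * rpoly P (?\<zeta> ^ (q - 1))" by blast
  qed
  ultimately have "rat_vs.span (hurwitz_odd k q ` lower_units q) \<subseteq> ?T"
    by (intro rat_vs.span_minimal)
  then show ?thesis using z by blast
qed

text \<open>The two expressions for z form one polynomial relation at a root of unity of order q r,
  and a suitable conjugation changes the sign of one side only.\<close>

lemma span_hurwitz_odd_coprime_Int:
  assumes k: "k > 1" "odd k" and q: "q > 2" and r: "r > 2" and qr: "coprime q r"
    and zq: "z \<in> rat_vs.span (hurwitz_odd k q ` lower_units q)"
    and zr: "z \<in> rat_vs.span (hurwitz_odd k r ` lower_units r)"
  shows "z = 0"
proof -
  let ?\<zeta> = "cis (2 * pi / real (q * r))"
  have \<zeta>qr: "?\<zeta> ^ (q * r) = 1" using q r by (intro cis_root_power) auto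
  have \<zeta>q: "?\<zeta> ^ r = cis (2 * pi / real q)" and \<zeta>r: "?\<zeta> ^ q = cis (2 * pi / real r)"
    using q r by (simp_all add: Complex.DeMoivre)
  have \<zeta>1: "cis (2 * pi / real q) ^ q = 1" "cis (2 * pi / real r) ^ r = 1"
    using q r by (auto intro!: cis_root_power)
  obtain P where P: "z = \<i> * rpoly P (cis (2 * pi / real q))"
    "- z = \<i> * rpoly P (cis (2 * pi / real q) ^ (q - 1))"
    using span_hurwitz_odd_conjugate[OF k q zq] by blast
  obtain R where R: "z = \<i> * rpoly R (cis (2 * pi / real r))"
    using span_hurwitz_odd_conjugate[OF k r zr] by blast
  \<comment> \<open>This exponent inverts the q-th roots of unity and fixes the r-th ones.\<close>
  obtain t where t: "[t = q - 1] (mod q)" "[t = 1] (mod r)"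
    using binary_chinese_remainder_nat[OF qr] by blast
  have "coprime t q"
    using t(1) q coprime_diff_one_left_nat[of q] by (metis cong_imp_coprime cong_sym gr0I not_less0)
  moreover have "coprime t r"
    using t(2) by (metis cong_imp_coprime cong_sym coprime_1_left)
  ultimately have t_coprime: "coprime t (q * r)" by simp
  define S where "S = pcompose P (monom 1 r) - pcompose R (monom 1 q)"
  have S: "rpoly S x = rpoly P (x ^ r) - rpoly R (x ^ q)" for x
    by (simp add: S_def rat_ev.ev_diff rat_ev.ev_pcompose rat_ev.ev_monom)
  have "\<i> * rpoly S ?\<zeta> = 0"
    using P(1) R by (simp only: S \<zeta>q \<zeta>r right_diff_distrib) simp
  then have "rpoly S (?\<zeta> ^ t) = 0"
    using q r \<zeta>qr t_coprime by (intro rpoly_root_of_unity_conjugate[of "q * r"]) auto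
  moreover have "(?\<zeta> ^ t) ^ r = cis (2 * pi / real q) ^ (q - 1)"
  proof -
    have "(?\<zeta> ^ t) ^ r = cis (2 * pi / real q) ^ t"
      unfolding \<zeta>q[symmetric] by (simp add: mult.commute flip: power_mult)
    also have "\<dots> = cis (2 * pi / real q) ^ (q - 1)"
      using t(1) root_of_unity_power_mod[OF \<zeta>1(1)] by (metis cong_def)
    finally show ?thesis .
  qed
  moreover have "(?\<zeta> ^ t) ^ q = cis (2 * pi / real r)"
  proof -
    have "(?\<zeta> ^ t) ^ q = cis (2 * pi / real r) ^ t"
      unfolding \<zeta>r[symmetric] by (simp add: mult.commute flip: power_mult)
    also have "\<dots> = cis (2 * pi / real r) ^ 1"
      using t(2) root_of_unity_power_mod[OF \<zeta>1(2)] by (metis cong_def)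
    finally show ?thesis by simp
  qed
  ultimately have "rpoly P (cis (2 * pi / real q) ^ (q - 1)) = rpoly R (cis (2 * pi / real r))"
    by (simp add: S)
  then have "- z = z" using P(2) R by simp
  then show ?thesis by simp
qed

section \<open>The dimension count\<close>

lemma (in vector_space) card_independent_le_dim_span:
  assumes "independent B" "B \<subseteq> span S" "finite S"
  shows "card B \<le> dim (span S)"
proof -
  obtain B' where B': "B \<subseteq> B'" "B' \<subseteq> span S" "independent B'" "span S \<subseteq> span B'"
    using maximal_independent_subset_extend[OF assms(2,1)] by blast
  \<comment> \<open>For an infinite basis \<open>card\<close> would be 0, so the finiteness of S is
    essential for the bound.\<close>
  have "finite B'" using independent_span_bound[OF assms(3) B'(3,2)] by simp
  then have "card B \<le> card B'" using B'(1) by (rule card_mono)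
  also have "card B' = dim (span S)" using B' by (intro basis_card_eq_dim)
  finally show ?thesis .
qed

text \<open>The units up to sign supply \<open>totient q\<close> / 2 independent odd values, and the
  zeta value is one further independent vector.\<close>

lemma dim_hurwitz_space_ge:
  assumes k: "k > 1" "odd k" and q: "q > 2"
    and not_in: "scaled_zeta k \<notin> rat_vs.span (hurwitz_odd k q ` lower_units q)"
  shows "real (rat_dim (hurwitz_space k q)) \<ge> real (totient q) / 2 + 1"
proof -
  let ?O = "hurwitz_odd k q ` lower_units q"
  have "rat_vs.independent (insert (scaled_zeta k) ?O)"
    using not_in independent_hurwitz_odd[OF k q] by (rule rat_vs.independent_insertI)
  moreover have "?O \<subseteq> hurwitz_space k q"
  proof safe
    fix a assume "a \<in> lower_units q"
    then have "a \<in> units_below q" "q - a \<in> units_below q"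
      using q units_below_reflect[of q a] by (auto simp: lower_units_def)
    then show "hurwitz_odd k q a \<in> hurwitz_space k q"
      unfolding hurwitz_space_eq hurwitz_odd_def
      by (intro rat_vs.span_diff rat_vs.span_base imageI)
  qed
  ultimately have "card (insert (scaled_zeta k) ?O) \<le> rat_dim (hurwitz_space k q)"
    using scaled_zeta_in_hurwitz_space[OF k(1) q] unfolding hurwitz_space_eq
    by (intro rat_vs.card_independent_le_dim_span) auto
  moreover have "scaled_zeta k \<notin> ?O" using not_in rat_vs.span_base by blast
  ultimately have "card (lower_units q) + 1 \<le> rat_dim (hurwitz_space k q)"
    by (simp add: card_image inj_on_hurwitz_odd[OF k q])
  then show ?thesis by (simp add: totient_eq_card_lower_units[OF q])
qed

theorem theorem5p5:
  fixes k :: nat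
  assumes "k > 1" and "odd k"
  shows "\<exists>q0::nat. q0 > 2 \<and>
    (\<forall>q::nat. q > 2 \<and> coprime q q0 \<longrightarrow>
      real (rat_dim (hurwitz_space k q)) \<ge> real (totient q) / 2 + 1)"
proof (cases "\<exists>r>2. scaled_zeta k \<in> rat_vs.span (hurwitz_odd k r ` lower_units r)")
  case True
  then obtain r where r: "r > 2" "scaled_zeta k \<in> rat_vs.span (hurwitz_odd k r ` lower_units r)"
    by blast
  \<comment> \<open>The exceptional modulus r serves as \<open>q0\<close>: for q coprime to r the
    zeta value cannot lie in both odd spans, since it is nonzero.\<close>
  have "real (rat_dim (hurwitz_space k q)) \<ge> real (totient q) / 2 + 1" if "q > 2" "coprime q r" for q
    using span_hurwitz_odd_coprime_Int[OF assms that(1) r(1) that(2) _ r(2)]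
      scaled_zeta_nonzero[OF assms(1)] that(1)
    by (intro dim_hurwitz_space_ge assms) auto
  then show ?thesis using r(1) by blast
next
  case False
  then have "real (rat_dim (hurwitz_space k q)) \<ge> real (totient q) / 2 + 1" if "q > 2" for q
    using that by (intro dim_hurwitz_space_ge assms) auto
  \<comment> \<open>Without exceptional moduli the bound holds for every q > 2, and 3 is merely the
    least admissible \<open>q0\<close>.\<close>
  then show ?thesis by (intro exI[of _ 3]) auto
qed

end
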